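(* Consider the Diophantine equation $xy = z^5$ in positive integers $x, y, z$. A triple $(x,y,z)$ of positive integers is a solution of this equation if and only if there exist positive integers $q, e_1, e_2, r_1, r_2, i_1, i_2$ with $\gcd(e_1,e_2)=\gcd(r_1,r_2)=\gcd(i_1,i_2)=1$ such that $$x = q^5 e_1^3 e_2^2 r_1^4 r_2\, i_1^5,\qquad y = q^5 e_1^2 e_2^3 r_1 r_2^4\, i_2^5,\qquad z = q^2 e_1 e_2 r_1 r_2 i_1 i_2 .$$ *)

theory Defs imports Main begin

end

theory Submission imports Defs "HOL-Computational_Algebra.Primes" begin

text \<open>
  Any two of \<open>x\<close>, \<open>y\<close>, \<open>z\<close> determine the third, so only the shape of \<open>(x, y)\<close> matters.
  It is found one prime at a time: if \<open>p\<close> has exponents \<open>a\<close> and \<open>b\<close> in \<open>x\<close> and \<open>y\<close>,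
  then \<open>5\<close> divides \<open>a + b\<close>; the common multiples of \<open>5\<close> go to \<open>q\<close>, the
  remaining ones to one of \<open>i1\<close>, \<open>i2\<close>, and the residues \<open>(1,4)\<close>, \<open>(2,3)\<close>, \<open>(3,2)\<close>, \<open>(4,1)\<close>
  to exactly one of \<open>r2\<close>, \<open>e2\<close>, \<open>e1\<close>, \<open>r1\<close>.
\<close>

text \<open>Positivity of the parameters is left out so that the induction need not carry it; it is
  recovered at the end from \<open>z > 0\<close>.\<close>

definition quintic_pair :: "nat \<Rightarrow> nat \<Rightarrow> bool" where
  "quintic_pair x y \<longleftrightarrow> (\<exists>q e1 e2 r1 r2 i1 i2.
     coprime e1 e2 \<and> coprime r1 r2 \<and> coprime i1 i2 \<and>
     x = q ^ 5 * e1 ^ 3 * e2 ^ 2 * r1 ^ 4 * r2 * i1 ^ 5 \<and>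
     y = q ^ 5 * e1 ^ 2 * e2 ^ 3 * r1 * r2 ^ 4 * i2 ^ 5)"

text \<open>The new variables are the exponents of a prime in \<open>q\<close>, \<open>e1\<close>,
  \<open>e2\<close>, \<open>r1\<close>, \<open>r2\<close>, \<open>i1\<close>, \<open>i2\<close>; the
  three disjunctions express coprimality of each pair at that prime.\<close>

lemma exponent_split:
  fixes a b c :: nat
  assumes "a + b = 5 * c"
  obtains k s1 s2 t1 t2 u1 u2 :: nat where
    "a = 5*k + 3*s1 + 2*s2 + 4*t1 + t2 + 5*u1"
    "b = 5*k + 2*s1 + 3*s2 + t1 + 4*t2 + 5*u2"
    "s1 = 0 \<or> s2 = 0" "t1 = 0 \<or> t2 = 0" "u1 = 0 \<or> u2 = 0"
proof -
  \<comment> \<open>Taking the minimum of the two quotients leaves an excess on at most one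
    side.\<close>
  define k where "k = min (a div 5) (b div 5)"
  define u1 where "u1 = a div 5 - k"
  define u2 where "u2 = b div 5 - k"
  have "k + u1 = a div 5" "k + u2 = b div 5" and u: "u1 = 0 \<or> u2 = 0"
    unfolding u1_def u2_def k_def by linarith+
  then have a: "a = 5*k + 5*u1 + a mod 5" and b: "b = 5*k + 5*u2 + b mod 5"
    using mult_div_mod_eq[of 5 a] mult_div_mod_eq[of 5 b] by linarith+
  have "(r = 0 \<and> s = 0) \<or> (r = 1 \<and> s = 4) \<or> (r = 2 \<and> s = 3) \<or> (r = 3 \<and> s = 2) \<or> (r = 4 \<and> s = 1)"
    if "(r + s) mod 5 = 0" "r < 5" "s < 5" for r s :: nat
    using that by presburger
  from this[of "a mod 5" "b mod 5"] consider "a mod 5 = 0" "b mod 5 = 0" | "a mod 5 = 1" "b mod 5 = 4"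
    | "a mod 5 = 2" "b mod 5 = 3" | "a mod 5 = 3" "b mod 5 = 2" | "a mod 5 = 4" "b mod 5 = 1"
    using assms by (auto simp: mod_add_eq)
  then show thesis
  proof cases
    case 1 then show thesis using that[of k 0 0 0 0 u1 u2] a b u by simp
  next
    case 2 then show thesis using that[of k 0 0 0 1 u1 u2] a b u by simp
  next
    case 3 then show thesis using that[of k 0 1 0 0 u1 u2] a b u by simp
  next
    case 4 then show thesis using that[of k 1 0 0 0 u1 u2] a b u by simp
  next
    case 5 then show thesis using that[of k 0 0 1 0 u1 u2] a b u by simp
  qed
qed

lemma coprime_mult_prime_powers:
  fixes p m n :: nat
  assumes "prime p" "\<not> p dvd m" "\<not> p dvd n" "coprime m n" "s = 0 \<or> t = 0"
  shows "coprime (m * p ^ s) (n * p ^ t)"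
proof -
  have "coprime p m" "coprime p n"
    using assms by (simp_all add: prime_imp_coprime)
  then show ?thesis
    using assms by (auto simp: coprime_commute)
qed

text \<open>Every old parameter divides \<open>x\<close> or \<open>y\<close>, hence is prime to
  \<open>p\<close>. Multiplying in powers of \<open>p\<close> therefore keeps a pair coprime as long
  as at most one of its members receives a positive power, which \<open>exponent_split\<close>
  guarantees.\<close>

lemma quintic_pair_mult_prime_powers:
  assumes "quintic_pair x y" and p: "prime p" "\<not> p dvd x" "\<not> p dvd y" and "a + b = 5 * c"
  shows "quintic_pair (p ^ a * x) (p ^ b * y)"
proof -
  obtain q e1 e2 r1 r2 i1 i2 where
    cop: "coprime e1 e2" "coprime r1 r2" "coprime i1 i2"
    and x: "x = q ^ 5 * e1 ^ 3 * e2 ^ 2 * r1 ^ 4 * r2 * i1 ^ 5"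
    and y: "y = q ^ 5 * e1 ^ 2 * e2 ^ 3 * r1 * r2 ^ 4 * i2 ^ 5"
    using assms(1) unfolding quintic_pair_def by blast
  obtain k s1 s2 t1 t2 u1 u2 where
    a: "a = 5*k + 3*s1 + 2*s2 + 4*t1 + t2 + 5*u1" and
    b: "b = 5*k + 2*s1 + 3*s2 + t1 + 4*t2 + 5*u2" and
    zero: "s1 = 0 \<or> s2 = 0" "t1 = 0 \<or> t2 = 0" "u1 = 0 \<or> u2 = 0"
    using exponent_split[OF assms(5)] .
  have nd: "\<not> p dvd e1" "\<not> p dvd e2" "\<not> p dvd r1" "\<not> p dvd r2" "\<not> p dvd i1" "\<not> p dvd i2"
    using p by (auto simp: x y prime_dvd_mult_iff prime_dvd_power_iff)
  have "coprime (e1 * p ^ s1) (e2 * p ^ s2)" "coprime (r1 * p ^ t1) (r2 * p ^ t2)"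
    "coprime (i1 * p ^ u1) (i2 * p ^ u2)"
    using coprime_mult_prime_powers p(1) nd cop zero by blast+
  moreover have "p ^ a * x = (q * p ^ k) ^ 5 * (e1 * p ^ s1) ^ 3 * (e2 * p ^ s2) ^ 2 *
      (r1 * p ^ t1) ^ 4 * (r2 * p ^ t2) * (i1 * p ^ u1) ^ 5"
    unfolding a x by (simp add: power_add power_mult_distrib mult.commute flip: power_mult)
  moreover have "p ^ b * y = (q * p ^ k) ^ 5 * (e1 * p ^ s1) ^ 2 * (e2 * p ^ s2) ^ 3 *
      (r1 * p ^ t1) * (r2 * p ^ t2) ^ 4 * (i2 * p ^ u2) ^ 5"
    unfolding b y by (simp add: power_add power_mult_distrib mult.commute flip: power_mult)
  ultimately show ?thesis
    unfolding quintic_pair_def by blast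
qed

text \<open>Strong induction on \<open>z\<close>: removing the full power of a prime
  \<open>p\<close> from \<open>x\<close>, \<open>y\<close> and \<open>z\<close> leaves the same
  equation with a smaller \<open>z\<close>.\<close>

lemma quintic_pair_if_mult_eq_power5:
  fixes x y z :: nat
  assumes "x * y = z ^ 5" "z > 0"
  shows "quintic_pair x y"
  using assms
proof (induction z arbitrary: x y rule: less_induct)
  case (less z)
  show ?case
  proof (cases "z = 1")
    case True
    then have "x = 1" "y = 1"
      using less.prems by simp_all
    moreover have "quintic_pair 1 1"
      unfolding quintic_pair_def by (intro exI[of _ 1]) simp
    ultimately show ?thesis by simp
  next
    case False
    then obtain p where p: "prime p" "p dvd z"
      using prime_factor_nat by blast
    have "x * y > 0"
      using less.prems by simp
    then have nz: "x \<noteq> 0" "y \<noteq> 0" "z \<noteq> 0"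
      using less.prems(2) by auto
    define a b c where "a = multiplicity p x" and "b = multiplicity p y" and "c = multiplicity p z"
    have "multiplicity p (x * y) = multiplicity p (z ^ 5)"
      using less.prems by simp
    then have abc: "a + b = 5 * c"
      using p nz unfolding a_def b_def c_def
      by (simp add: prime_elem_multiplicity_mult_distrib prime_elem_multiplicity_power_distrib)
    have unit: "\<not> is_unit p"
      using p(1) by auto
    obtain x' where x': "x = p ^ a * x'" "\<not> p dvd x'"
      using multiplicity_decompose'[OF nz(1) unit] unfolding a_def b_def c_def by blast
    obtain y' where y': "y = p ^ b * y'" "\<not> p dvd y'"
      using multiplicity_decompose'[OF nz(2) unit] unfolding a_def b_def c_def by blast
    obtain z' where z': "z = p ^ c * z'" "\<not> p dvd z'"
      using multiplicity_decompose'[OF nz(3) unit] unfolding a_def b_def c_def by blast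
    have "p ^ (5 * c) * (x' * y') = x * y"
      by (simp add: x'(1) y'(1) power_add flip: abc)
    also have "\<dots> = p ^ (5 * c) * z' ^ 5"
      by (simp add: less.prems(1) z'(1) power_mult_distrib mult.commute flip: power_mult)
    finally have eq: "x' * y' = z' ^ 5"
      using p(1) by (simp add: prime_gt_0_nat)
    have "z' > 0"
      using z'(1) nz(3) by (cases z') auto
    \<comment> \<open>Since \<open>p\<close> divides \<open>z\<close>, a nontrivial power was
      removed, so the induction descends.\<close>
    have "c \<noteq> 0"
      using p(2) z' by (cases c) auto
    then have "p ^ c > 1"
      using one_less_power[OF prime_gt_1_nat[OF p(1)]] by simp
    then have "z' < z"
      using \<open>z' > 0\<close> z'(1) by simp
    then have "quintic_pair x' y'"
      using less.IH eq \<open>z' > 0\<close> by blast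
    then show ?thesis
      using quintic_pair_mult_prime_powers p(1) x' y' abc by blast
  qed
qed

theorem theorem5:
  fixes x y z :: nat
  assumes "x > 0" and "y > 0" and "z > 0"
  shows "x * y = z ^ 5 \<longleftrightarrow>
    (\<exists>q e1 e2 r1 r2 i1 i2 :: nat.
       q > 0 \<and> e1 > 0 \<and> e2 > 0 \<and> r1 > 0 \<and> r2 > 0 \<and> i1 > 0 \<and> i2 > 0 \<and>
       gcd e1 e2 = 1 \<and> gcd r1 r2 = 1 \<and> gcd i1 i2 = 1 \<and>
       x = q ^ 5 * e1 ^ 3 * e2 ^ 2 * r1 ^ 4 * r2 * i1 ^ 5 \<and>
       y = q ^ 5 * e1 ^ 2 * e2 ^ 3 * r1 * r2 ^ 4 * i2 ^ 5 \<and>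
       z = q ^ 2 * e1 * e2 * r1 * r2 * i1 * i2)"
    (is "_ \<longleftrightarrow> ?rhs")
proof
  \<comment> \<open>The exponents add up to 10 for \<open>q\<close> and to 5 for every other
    parameter. This identity serves both directions.\<close>
  have prod: "(q ^ 5 * e1 ^ 3 * e2 ^ 2 * r1 ^ 4 * r2 * i1 ^ 5) *
      (q ^ 5 * e1 ^ 2 * e2 ^ 3 * r1 * r2 ^ 4 * i2 ^ 5) =
      (q ^ 2 * e1 * e2 * r1 * r2 * i1 * i2) ^ 5" for q e1 e2 r1 r2 i1 i2 :: nat
    by algebra
  show "x * y = z ^ 5" if ?rhs
    using that prod by blast
  show ?rhs if xy: "x * y = z ^ 5"
  proof -
    obtain q e1 e2 r1 r2 i1 i2 where
      cop: "coprime e1 e2" "coprime r1 r2" "coprime i1 i2"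
      and x: "x = q ^ 5 * e1 ^ 3 * e2 ^ 2 * r1 ^ 4 * r2 * i1 ^ 5"
      and y: "y = q ^ 5 * e1 ^ 2 * e2 ^ 3 * r1 * r2 ^ 4 * i2 ^ 5"
      using quintic_pair_if_mult_eq_power5[OF xy assms(3)] unfolding quintic_pair_def by blast
    \<comment> \<open>Fifth powers are injective on the naturals, so the formula for
      \<open>z\<close> follows from those for \<open>x\<close> and \<open>y\<close>.\<close>
    have "z ^ 5 = (q ^ 2 * e1 * e2 * r1 * r2 * i1 * i2) ^ 5"
      using prod xy x y by simp
    then have z: "z = q ^ 2 * e1 * e2 * r1 * r2 * i1 * i2"
      by (rule power_eq_imp_eq_base) simp_all
    \<comment> \<open>Each parameter is a factor of the positive number \<open>z\<close>.\<close>
    have "q > 0" "e1 > 0" "e2 > 0" "r1 > 0" "r2 > 0" "i1 > 0" "i2 > 0"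
      using assms(3) z by simp_all
    then show ?rhs
      using cop x y z unfolding coprime_iff_gcd_eq_1
      by (intro exI[of _ q] exI[of _ e1] exI[of _ e2] exI[of _ r1] exI[of _ r2]
          exI[of _ i1] exI[of _ i2] conjI)
  qed
qed

end
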